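(* For every single-winner rule $R$ and every $s\in(0,1)$, we have $\mathrm{FVR}(R,s)\ge 1-s$. Moreover, for each $s\in(0,1)$ there exists a single-winner rule $R$ such that $\mathrm{FVR}(R,s)=1-s$.
   Context: An (approval) instance consists of a finite non-empty set $N$ of $n$ voters, a finite non-empty set $M$ of $m$ candidates, and an approval set $A_i\subseteq M$ for each voter $i\in N$. A single-winner rule $R$ selects, for every instance (for all $n$ and $m$), a single candidate in $M$. For a voter $i$, let $f_i=|A_i|/m$; for $s\in(0,1)$, voter $i$ is $s$-flexible if $f_i\ge s$. Voter $i$ approves candidate $a$ if $a\in A_i$. For a rule $R$ and $s\in(0,1)$, $\mathrm{FVR}(R,s)$ is the smallest $r\in[0,1]$ such that for every instance (over all $n$, $m$ and all approval sets), whenever a group of strictly more than $rn$ voters are all $s$-flexible, at least one voter in the group approves the candidate chosen by $R$ on that instance. (This minimum always exists.) *)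

theory Defs
  imports Complex_Main "HOL-Library.FuncSet" "HOL-Library.Infinite_Typeclass"
begin

text \<open>
  Voters and candidates are drawn from universes \<open>'v\<close> and \<open>'c\<close>. To have instances of every
  size \<open>n\<close> and \<open>m\<close>, these universes must be infinite; this is demanded, where it matters, by the
  sort \<open>infinite\<close>.

  The profile is extensional (undefined outside \<open>N\<close>), so that a rule, which is a function of
  \<open>N\<close>, \<open>M\<close> and \<open>A\<close>, depends on nothing but the instance.
\<close>

definition approval_instance :: "'v set \<Rightarrow> 'c set \<Rightarrow> ('v \<Rightarrow> 'c set) \<Rightarrow> bool" where
  "approval_instance N M A \<longleftrightarrow>
     finite N \<and> N \<noteq> {} \<and> finite M \<and> M \<noteq> {} \<and> A \<in> N \<rightarrow>\<^sub>E Pow M"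

type_synonym ('v, 'c) rule = "'v set \<Rightarrow> 'c set \<Rightarrow> ('v \<Rightarrow> 'c set) \<Rightarrow> 'c"

definition single_winner_rule :: "('v, 'c) rule \<Rightarrow> bool" where
  "single_winner_rule R \<longleftrightarrow> (\<forall>N M A. approval_instance N M A \<longrightarrow> R N M A \<in> M)"

definition flexibility :: "'c set \<Rightarrow> ('v \<Rightarrow> 'c set) \<Rightarrow> 'v \<Rightarrow> real" where
  "flexibility M A i = real (card (A i)) / real (card M)"

definition flexible :: "real \<Rightarrow> 'c set \<Rightarrow> ('v \<Rightarrow> 'c set) \<Rightarrow> 'v \<Rightarrow> bool" where
  "flexible s M A i \<longleftrightarrow> flexibility M A i \<ge> s"

definition represents_flexible :: "('v, 'c) rule \<Rightarrow> real \<Rightarrow> real \<Rightarrow> bool" where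
  "represents_flexible R s r \<longleftrightarrow>
     (\<forall>N M A. approval_instance N M A \<longrightarrow>
       (\<forall>G \<subseteq> N. real (card G) > r * real (card N) \<and> (\<forall>i\<in>G. flexible s M A i) \<longrightarrow>
         (\<exists>i\<in>G. R N M A \<in> A i)))"

definition FVR :: "('v, 'c) rule \<Rightarrow> real \<Rightarrow> real" where
  "FVR R s = (LEAST r. r \<in> {0..1} \<and> represents_flexible R s r)"

text \<open>The minimum exists, so \<open>LEAST\<close> in the definition of \<open>FVR\<close> is meaningful.\<close>

lemma FVR_is_minimum:
  fixes R :: "('v, 'c) rule"
  shows "FVR R s \<in> {0..1}"
    and "represents_flexible R s (FVR R s)"
    and "\<And>r. r \<in> {0..1} \<Longrightarrow> represents_flexible R s r \<Longrightarrow> FVR R s \<le> r"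
proof -
  define P where "P = (\<lambda>r. r \<in> {0..1} \<and> represents_flexible R s r)"
  define q where "q = Inf {r. P r}"
  have "represents_flexible R s 1"
    unfolding represents_flexible_def approval_instance_def
    by (auto dest: card_mono)
  then have P1: "P 1"
    by (simp add: P_def)
  have bdd: "bdd_below {r. P r}"
    by (rule bdd_belowI[of _ 0]) (auto simp: P_def)
  have low: "q \<le> r" if "P r" for r
    unfolding q_def using that bdd by (auto intro: cInf_lower)
  have q0: "q \<ge> 0"
    unfolding q_def using P1 by (intro cInf_greatest) (auto simp: P_def)
  have "represents_flexible R s q"
    unfolding represents_flexible_def
  proof (intro allI impI)
    fix N :: "'v set" and M :: "'c set" and A G
    assume inst: "approval_instance N M A" and G: "G \<subseteq> N"
      and *: "real (card G) > q * real (card N) \<and> (\<forall>i\<in>G. flexible s M A i)"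
    have n: "real (card N) > 0"
      using inst by (auto simp: approval_instance_def card_gt_0_iff)
    have "q < real (card G) / real (card N)"
      using * n by (simp add: field_simps)
    then obtain r where r: "P r" "r < real (card G) / real (card N)"
      unfolding q_def using P1 bdd by (subst (asm) cInf_less_iff) auto
    have "real (card G) > r * real (card N)"
      using r(2) n by (simp add: field_simps)
    then show "\<exists>i\<in>G. R N M A \<in> A i"
      using r(1) inst G * unfolding P_def represents_flexible_def by blast
  qed
  then have Pq: "P q"
    using q0 low[OF P1] by (simp add: P_def)
  have "FVR R s = q"
    unfolding FVR_def using Pq low by (intro Least_equality) (auto simp: P_def)
  then show "FVR R s \<in> {0..1}" "represents_flexible R s (FVR R s)"
    "\<And>r. r \<in> {0..1} \<Longrightarrow> represents_flexible R s r \<Longrightarrow> FVR R s \<le> r"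
    using Pq low by (auto simp: P_def)
qed

end

theory Submission
  imports Defs
begin

text \<open>
  Lower bound: let \<open>m\<close> voters each approve a cyclic interval of \<open>k = \<lceil>s m\<rceil>\<close> out of \<open>m\<close> candidates.
  Everybody is \<open>s\<close>-flexible and every candidate, in particular the winner, is rejected by exactly
  \<open>m - k\<close> voters; the fraction \<open>(m - k) / m\<close> tends to \<open>1 - s\<close>.
  Upper bound: averaging over the candidates, some candidate is approved by at least a fraction \<open>s\<close>
  of the \<open>s\<close>-flexible voters, and a rule may select such a candidate.
\<close>

text \<open>Translation by \<open>j\<close> permutes the residues modulo \<open>m\<close>, so
  exactly \<open>k\<close> of them are sent into \<open>{..<k}\<close>.\<close>

lemma card_add_mod_less:
  fixes j k m :: nat
  assumes "k \<le> m"
  shows "card {i\<in>{..<m}. (i + j) mod m < k} = k"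
proof -
  let ?f = "\<lambda>i. (i + j) mod m" and ?S = "{i\<in>{..<m}. (i + j) mod m < k}"
  have inj: "inj_on ?f {..<m}"
  proof (rule linorder_inj_onI)
    fix x y
    assume "x < y" "x \<in> {..<m}" "y \<in> {..<m}"
    \<comment> \<open>The difference is \<open>y - x\<close>, which lies strictly between 0 and
      \<open>m\<close>.\<close>
    then have "\<not> m dvd (y + j) - (x + j)"
      by (auto dest: dvd_imp_le)
    then show "?f x \<noteq> ?f y"
      using \<open>x < y\<close> mod_eq_dvd_iff_nat[of "x + j" "y + j" m] by simp
  qed auto
  have "?f ` {..<m} = {..<m}"
    by (rule endo_inj_surj[OF _ _ inj]) auto
  moreover have "?f ` ?S = ?f ` {..<m} \<inter> {..<k}"
    by auto
  ultimately have "?f ` ?S = {..<k}"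
    using assms by auto
  moreover have "inj_on ?f ?S"
    using inj by (rule inj_on_subset) auto
  ultimately show ?thesis
    using card_image[of ?f ?S] by simp
qed

text \<open>The approval condition \<open>(g c + f i) mod m < k\<close> is symmetric in voter and
  candidate, so a single count yields both the ballot sizes and the numbers of supporters.\<close>

lemma exists_cyclic_instance:
  fixes k m :: nat
  assumes "0 < m" "k \<le> m"
  obtains N :: "'v::infinite set" and M :: "'c::infinite set" and A
  where "approval_instance N M A" "card N = m" "card M = m"
    "\<And>i. i \<in> N \<Longrightarrow> card (A i) = k" "\<And>c. c \<in> M \<Longrightarrow> card {i\<in>N. c \<in> A i} = k"
proof -
  obtain N :: "'v set" where N: "finite N" "card N = m"
    using infinite_arbitrarily_large[OF infinite_UNIV] by blast
  obtain M :: "'c set" where M: "finite M" "card M = m"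
    using infinite_arbitrarily_large[OF infinite_UNIV] by blast
  obtain f where f: "bij_betw f N {..<m}"
    using N by (metis card_lessThan finite_lessThan finite_same_card_bij)
  obtain g where g: "bij_betw g M {..<m}"
    using M by (metis card_lessThan finite_lessThan finite_same_card_bij)
  define A where "A = (\<lambda>i\<in>N. {c\<in>M. (g c + f i) mod m < k})"
  \<comment> \<open>The type \<open>'x\<close> is kept generic: the count is applied to
    \<open>g\<close> on candidates and to \<open>f\<close> on voters.\<close>
  have count: "card {x\<in>X. (h x + j) mod m < k} = k"
    if h: "bij_betw h X {..<m}" for h :: "'x \<Rightarrow> nat" and X j
  proof -
    have "bij_betw h {x\<in>X. (h x + j) mod m < k} {i\<in>{..<m}. (i + j) mod m < k}"
      by (rule bij_betw_Collect[OF h]) simp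
    then show ?thesis
      using card_add_mod_less[OF \<open>k \<le> m\<close>, of j] by (simp only: bij_betw_same_card)
  qed
  show thesis
  proof
    show "approval_instance N M A"
      using N M \<open>0 < m\<close> by (auto simp: approval_instance_def A_def)
    show "card (A i) = k" if "i \<in> N" for i
      using that count[OF g] by (simp add: A_def)
    show "card {i\<in>N. c \<in> A i} = k" if "c \<in> M" for c
    proof -
      have "{i\<in>N. c \<in> A i} = {i\<in>N. (f i + g c) mod m < k}"
        using that by (auto simp: A_def add.commute)
      then show ?thesis
        using count[OF f] by simp
    qed
  qed (use N M in auto)
qed

lemma FVR_ge:
  fixes R :: "('v::infinite, 'c::infinite) rule"
  assumes R: "single_winner_rule R" and s: "s \<in> {0<..<1}"
  shows "FVR R s \<ge> 1 - s"
proof (rule ccontr)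
  define r where "r = FVR R s"
  assume "\<not> FVR R s \<ge> 1 - s"
  then have "0 < 1 - s - r"
    by (simp add: r_def)
  \<comment> \<open>Rounding \<open>s * m\<close> up to \<open>k\<close> costs less than one voter,
    and \<open>m\<close> is so large that one voter is less than the gap
    \<open>(1 - s - r) * m\<close>.\<close>
  then obtain m :: nat where m: "0 < m" "1 / m < 1 - s - r"
    by (metis nat_approx_posE of_nat_0_less_iff zero_less_Suc)
  define k where "k = nat \<lceil>s * m\<rceil>"
  have k: "s * m \<le> k" "k < s * m + 1"
    using s ceiling_correct[of "s * m"] unfolding k_def by (auto simp: of_nat_nat)
  have "s * m \<le> m"
    using s m(1) by simp
  then have "k \<le> m"
    unfolding k_def by linarith
  obtain N :: "'v set" and M :: "'c set" and A where
    inst: "approval_instance N M A" and card: "card N = m" "card M = m"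
    and cA: "\<And>i. i \<in> N \<Longrightarrow> card (A i) = k"
    and cN: "\<And>c. c \<in> M \<Longrightarrow> card {i\<in>N. c \<in> A i} = k"
    using exists_cyclic_instance[OF \<open>0 < m\<close> \<open>k \<le> m\<close>] by blast
  define G where "G = N - {i\<in>N. R N M A \<in> A i}"
  have "R N M A \<in> M"
    using R inst by (simp add: single_winner_rule_def)
  then have "card G = m - k"
    unfolding G_def using inst card(1) cN
    by (subst card_Diff_subset) (auto simp: approval_instance_def)
  moreover have "1 < (1 - s - r) * m"
    using m by (simp add: field_simps)
  \<comment> \<open>Indeed \<open>m - k > (1 - s) * m - 1 > r * m\<close>.\<close>
  ultimately have "real (card G) > r * real (card N)"
    using k(2) \<open>k \<le> m\<close> card(1) by (simp add: of_nat_diff algebra_simps)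
  moreover have "\<forall>i\<in>G. flexible s M A i"
    using k(1) m(1) cA card(2) by (auto simp: G_def flexible_def flexibility_def field_simps)
  moreover have "G \<subseteq> N"
    by (auto simp: G_def)
  \<comment> \<open>The minimum is attained, so the guarantee holds at \<open>r\<close> itself, yet
    \<open>G\<close> consists of the voters who reject the winner.\<close>
  ultimately have "\<exists>i\<in>G. R N M A \<in> A i"
    using FVR_is_minimum(2)[of R s] inst unfolding represents_flexible_def r_def by blast
  then show False
    by (auto simp: G_def)
qed

text \<open>Double counting of approvals by flexible voters: each of them contributes at least
  \<open>s * card M\<close>, so not every candidate can stay below the average.\<close>

lemma exists_candidate_approved_by_flexible:
  assumes inst: "approval_instance N M A"
  shows "\<exists>c\<in>M. s * card {i\<in>N. flexible s M A i} \<le> card {i\<in>N. flexible s M A i \<and> c \<in> A i}"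
proof (rule ccontr)
  define F where "F = {i\<in>N. flexible s M A i}"
  have fin: "finite F" "finite M" "M \<noteq> {}" and sub: "\<And>i. i \<in> F \<Longrightarrow> A i \<subseteq> M"
    using inst by (auto simp: approval_instance_def F_def)
  have M0: "card M > 0"
    using fin by (simp add: card_gt_0_iff)
  assume "\<not> ?thesis"
  then have less: "real (card {i\<in>F. c \<in> A i}) < s * card F" if "c \<in> M" for c
    using that by (force simp: F_def not_le)
  have "s * card M * card F = (\<Sum>i\<in>F. s * card M)"
    by simp
  also have "\<dots> \<le> (\<Sum>i\<in>F. real (card (A i)))"
    using M0 by (intro sum_mono) (auto simp: F_def flexible_def flexibility_def field_simps)
  \<comment> \<open>This puts the sum into incidence form, so that the order of counting can be
    exchanged.\<close>
  also have "\<dots> = real (\<Sum>i\<in>F. card {c\<in>M. c \<in> A i})"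
  proof -
    have "{c\<in>M. c \<in> A i} = A i" if "i \<in> F" for i
      using sub[OF that] by blast
    then show ?thesis
      by simp
  qed
  also have "(\<Sum>i\<in>F. card {c\<in>M. c \<in> A i}) = (\<Sum>c\<in>M. card {i\<in>F. c \<in> A i})"
    using fin by (intro sum_multicount_gen) auto
  also have "real \<dots> = (\<Sum>c\<in>M. real (card {i\<in>F. c \<in> A i}))"
    by simp
  also have "\<dots> < (\<Sum>c\<in>M. s * card F)"
    using fin less by (intro sum_strict_mono) auto
  finally show False
    by (simp add: algebra_simps)
qed

text \<open>A flexible group \<open>G\<close> rejecting the winner is disjoint from the flexible
  supporters \<open>H\<close>, so its size is at most \<open>(1 - s) * card F\<close>, hence at most
  \<open>(1 - s) * card N\<close>. The rule may depend on \<open>s\<close>.\<close>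

lemma exists_optimal_rule:
  fixes s :: real
  assumes s: "s \<in> {0<..<1}"
  obtains R :: "('v, 'c) rule" where "single_winner_rule R" "represents_flexible R s (1 - s)"
proof -
  define P where "P = (\<lambda>(N :: 'v set) (M :: 'c set) A c. c \<in> M \<and>
    s * card {i\<in>N. flexible s M A i} \<le> card {i\<in>N. flexible s M A i \<and> c \<in> A i})"
  define R :: "('v, 'c) rule" where "R = (\<lambda>N M A. SOME c. P N M A c)"
  have "P N M A (R N M A)" if "approval_instance N M A" for N M A
    unfolding R_def using exists_candidate_approved_by_flexible[OF that, of s]
    by (intro someI_ex[of "P N M A"]) (auto simp: P_def)
  then have R: "R N M A \<in> M"
    and popular: "s * card {i\<in>N. flexible s M A i} \<le>
      card {i\<in>N. flexible s M A i \<and> R N M A \<in> A i}"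
    if "approval_instance N M A" for N M A
    using that by (auto simp: P_def)
  have "represents_flexible R s (1 - s)"
    unfolding represents_flexible_def
  proof (intro allI impI, rule ccontr)
    fix N :: "'v set" and M :: "'c set" and A G
    define F where "F = {i\<in>N. flexible s M A i}"
    define H where "H = {i\<in>N. flexible s M A i \<and> R N M A \<in> A i}"
    assume inst: "approval_instance N M A" and "G \<subseteq> N"
      and G: "real (card G) > (1 - s) * real (card N) \<and> (\<forall>i\<in>G. flexible s M A i)"
      and "\<not> (\<exists>i\<in>G. R N M A \<in> A i)"
    then have fin: "finite N" and disj: "G \<inter> H = {}" and sub: "G \<union> H \<subseteq> F" "F \<subseteq> N"
      by (auto simp: approval_instance_def F_def H_def)
    have "finite F"
      using fin sub by (metis finite_subset)
    then have "card G + card H \<le> card F"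
      using sub(1) disj by (metis card_Un_disjoint card_mono finite_Un finite_subset)
    moreover have "s * card F \<le> card H"
      using popular[OF inst] by (simp add: F_def H_def)
    moreover have "(1 - s) * card F \<le> (1 - s) * card N"
      using s card_mono[OF fin sub(2)] by (intro mult_left_mono) auto
    ultimately show False
      using G by (simp add: algebra_simps)
  qed
  with R show thesis
    using that by (auto simp: single_winner_rule_def)
qed

theorem theorem2p2:
  shows "(\<forall>(R :: ('v::infinite, 'c::infinite) rule) s.
            single_winner_rule R \<longrightarrow> s \<in> {0<..<1} \<longrightarrow> FVR R s \<ge> 1 - s) \<and>
         (\<forall>s\<in>{0<..<1}. \<exists>R :: ('v, 'c) rule. single_winner_rule R \<and> FVR R s = 1 - s)"
proof (intro conjI allI impI ballI)
  fix s :: real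
  assume s: "s \<in> {0<..<1}"
  obtain R :: "('v, 'c) rule" where R: "single_winner_rule R" "represents_flexible R s (1 - s)"
    using exists_optimal_rule[OF s] by blast
  \<comment> \<open>Minimality applies because \<open>1 - s\<close> lies in
    \<open>{0..1}\<close>.\<close>
  have "FVR R s \<le> 1 - s"
    using s R(2) by (intro FVR_is_minimum(3)) auto
  then show "\<exists>R :: ('v, 'c) rule. single_winner_rule R \<and> FVR R s = 1 - s"
    using FVR_ge[OF R(1) s] R(1) by (intro exI[of _ R] conjI antisym)
qed (rule FVR_ge)

end
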